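(* If $k$, $n$ and $r$ are integers such that $n \geq 1$, $r \geq 2$, and $0 \leq k \leq n(r-1)$, then $$\binom{n, r}{k} = \left\lfloor \left( \frac{r^{rn} - 1}{r^{n+k} - r^k} \right)^n \right\rfloor \bmod r^n,$$ where $\binom{n, r}{k}$ denotes the coefficient of $x^k$ in the polynomial $(x^0 + x^1 + \cdots + x^{r-1})^n$.
   Context: The number $\binom{n, r}{k} = [x^k](x^0 + \cdots + x^{r-1})^n$ is called a polynomial coefficient. For an integer $a$ and a positive integer $b$, $a \bmod b$ denotes the remainder $a - b\lfloor a/b \rfloor \in \{0, \ldots, b-1\}$. The fraction inside the floor is an ordinary rational number, which is raised to the $n$-th power before the floor is taken. *)

theory Defs
  imports "HOL-Computational_Algebra.Polynomial"
begin

definition poly_coefficient :: "nat \<Rightarrow> nat \<Rightarrow> nat \<Rightarrow> int" where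
  "poly_coefficient n r k = coeff ((\<Sum>i<r. monom 1 i) ^ n) k"

end

theory Submission
  imports Defs
begin

text \<open>
  With \<open>B = r ^ n\<close> the fraction is \<open>(1 + B + \<dots> + B ^ (r - 1)) / r ^ k\<close>, so its \<open>n\<close>-th power is
  \<open>P(B) / B ^ k\<close> for \<open>P = (1 + x + \<dots> + x ^ (r - 1)) ^ n\<close>. The coefficients of \<open>P\<close> are nonnegative
  and sum to \<open>P(1) = B\<close>; since the constant term is \<open>1\<close>, each of them is less than \<open>B\<close>. They are
  therefore the base-\<open>B\<close> digits of \<open>P(B)\<close>.
\<close>

text \<open>Horner's scheme: \<open>pCons a p\<close> takes the value
  \<open>a + b * poly p b\<close>, and since \<open>0 \<le> a < b\<close>, dividing by
  \<open>b\<close> drops the digit \<open>a\<close> and leaves \<open>poly p b\<close>. Each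
  division thus shifts the index by one, so \<open>k\<close> must vary in the induction.\<close>

lemma poly_div_power_mod_eq_coeff:
  fixes p :: "int poly"
  assumes "\<And>i. 0 \<le> coeff p i" and "\<And>i. coeff p i < b"
  shows "poly p b div b ^ k mod b = coeff p k"
  using assms
proof (induction p arbitrary: k rule: pCons_induct)
  case 0
  then show ?case by simp
next
  case (pCons a p)
  have a: "0 \<le> a" "a < b"
    using pCons.prems[of 0] by simp_all
  have p: "0 \<le> coeff p i" "coeff p i < b" for i
    using pCons.prems[of "Suc i"] by simp_all
  have div_b: "(a + b * poly p b) div b = poly p b"
    using a by simp
  show ?case
  proof (cases k)
    case 0
    then show ?thesis using a by simp
  next
    case (Suc j)
    have "poly (pCons a p) b div b ^ k = (a + b * poly p b) div b div b ^ j"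
      using a Suc by (simp add: zdiv_zmult2_eq)
    then show ?thesis
      unfolding div_b using pCons.IH[OF p] Suc by simp
  qed
qed

lemma coeff_mult_nonneg:
  fixes p q :: "'a::linordered_idom poly"
  assumes "\<And>i. 0 \<le> coeff p i" and "\<And>i. 0 \<le> coeff q i"
  shows "0 \<le> coeff (p * q) k"
  using assms by (simp add: coeff_mult sum_nonneg)

lemma coeff_power_nonneg:
  fixes p :: "'a::linordered_idom poly"
  assumes "\<And>i. 0 \<le> coeff p i"
  shows "0 \<le> coeff (p ^ n) k"
proof (induction n arbitrary: k)
  case 0
  then show ?case by (simp add: coeff_1)
next
  case (Suc n)
  then show ?case by (simp add: assms coeff_mult_nonneg)
qed

lemma coeff_le_poly_1:
  fixes p :: "'a::linordered_idom poly"
  assumes "\<And>i. 0 \<le> coeff p i"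
  shows "coeff p k \<le> poly p 1"
proof (cases "k \<le> degree p")
  case True
  then show ?thesis
    using assms by (auto simp: poly_altdef intro: member_le_sum)
next
  case False
  then show ?thesis
    using assms by (simp add: coeff_eq_0 poly_altdef sum_nonneg)
qed

text \<open>Writing \<open>p = pCons a q\<close> gives \<open>poly p 1 = a + poly q 1\<close>. A
  coefficient of positive index belongs to \<open>q\<close>, hence is at most
  \<open>poly q 1\<close>, and \<open>a > 0\<close> makes the bound strict.\<close>

lemma coeff_less_poly_1:
  fixes p :: "'a::linordered_idom poly"
  assumes nonneg: "\<And>i. 0 \<le> coeff p i" and "0 < coeff p 0" and "coeff p 0 < poly p 1"
  shows "coeff p k < poly p 1"
proof (cases k)
  case 0
  then show ?thesis using assms by simp
next
  case (Suc j)
  obtain a q where p: "p = pCons a q"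
    by (cases p)
  have "0 \<le> coeff q i" for i
    using nonneg[of "Suc i"] p by simp
  then have "coeff q j \<le> poly q 1"
    by (rule coeff_le_poly_1)
  then show ?thesis
    using assms(2) p Suc by (simp add: add_pos_nonneg add_strict_increasing)
qed

theorem theorem5p1:
  fixes k n r :: nat
  assumes "n \<ge> 1" and "r \<ge> 2" and "0 \<le> k" and "k \<le> n * (r - 1)"
  shows "poly_coefficient n r k =
    \<lfloor>((of_nat r ^ (r * n) - 1) / (of_nat r ^ (n + k) - of_nat r ^ k) :: rat) ^ n\<rfloor>
      mod (int r ^ n)"
proof -
  define s :: "int poly" where "s = (\<Sum>i<r. monom 1 i)"
  define p where "p = s ^ n"
  define b where "b = int r ^ n"
  have poly_s: "poly s x = (\<Sum>i<r. x ^ i)" for x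
    by (simp add: s_def poly_sum poly_monom)
  have "0 \<le> coeff s i" for i
    by (simp add: s_def coeff_sum sum_nonneg)
  then have nonneg: "0 \<le> coeff p i" for i
    unfolding p_def by (rule coeff_power_nonneg)
  have "1 < b"
    unfolding b_def using assms by (intro one_less_power) simp_all
  \<comment> \<open>Evaluation at 0 yields the constant term; as \<open>r > 0\<close>, the summand
    \<open>0 ^ 0 = 1\<close> is present.\<close>
  have "poly s 0 = 1"
    using assms by (simp add: poly_s power_0_left if_distrib lessThan_Suc_eq_insert_0)
  then have coeff_0: "coeff p 0 = 1"
    by (simp add: p_def flip: poly_0_coeff_0)
  have "poly p 1 = b"
    by (simp add: p_def b_def poly_s)
  then have less: "coeff p i < b" for i
    using coeff_less_poly_1[of p i] nonneg coeff_0 \<open>1 < b\<close> by simp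

  define c where "c = (of_nat r :: rat)"
  have c: "c ^ n = of_int b" "c \<noteq> 0"
    using assms by (simp_all add: c_def b_def)
  have b1: "(of_int b :: rat) \<noteq> 1"
    using \<open>1 < b\<close> by simp
  \<comment> \<open>The denominator factors as \<open>c ^ k * (c ^ n - 1)\<close>, which leaves a
    geometric quotient in \<open>b = c ^ n\<close>.\<close>
  have "(c ^ (r * n) - 1) / (c ^ (n + k) - c ^ k) = (of_int b ^ r - 1) / (of_int b - 1) / c ^ k"
    by (simp add: c(1)[symmetric] power_add power_mult mult.commute[of r] algebra_simps)
  also have "\<dots> = of_int (poly s b) / c ^ k"
    using b1 by (simp add: poly_s geometric_sum)
  \<comment> \<open>Raising to the power \<open>n\<close> turns \<open>c ^ k\<close> into
    \<open>(c ^ n) ^ k = b ^ k\<close>, so the denominator becomes a power of the base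
    \<open>b\<close>.\<close>
  also have "\<dots> ^ n = of_int (poly p b) / of_int (b ^ k)"
    by (simp add: p_def power_divide c(1)[symmetric] mult.commute[of k] flip: power_mult)
  finally have "\<lfloor>((c ^ (r * n) - 1) / (c ^ (n + k) - c ^ k)) ^ n\<rfloor> = poly p b div b ^ k"
    by (simp only: floor_divide_of_int_eq)
  then show ?thesis
    using poly_div_power_mod_eq_coeff[OF nonneg less, of k]
    by (simp add: poly_coefficient_def c_def b_def p_def s_def)
qed

end
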